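(* Let $\omega=e^{2\pi i/3}$. Suppose that $\mathbb S$ is a SIC set in $\mathbb{CP}^2$ that contains $[0,1,-\omega]$, $[0,1,-\omega^2]$ and $\mathbf z[0,\theta]$ for some $\theta\in(-\tfrac12\pi,\tfrac12\pi]$. If $\mathbb S$ contains distinct points $\mathbf z[\sigma_1,\phi]$, $\mathbf z[\sigma_2,\phi]$ (with the same $\phi\in(-\tfrac12\pi,\tfrac12\pi]$) where $\sigma_1,\sigma_2\in(-\pi,\pi)$, then $\mathbb S$ is isometric to a midpoint solution.
   Context: For $\mathbf z\in\mathbb C^3\setminus\{0\}$, $[\mathbf z]=[z_1,z_2,z_3]$ denotes the corresponding point of $\mathbb{CP}^2$, and $\langle\mathbf w,\mathbf z\rangle=\sum_i\overline{w_i}z_i$. For real $\sigma,\phi$, $\mathbf z[\sigma,\phi]\in\mathbb{CP}^2$ denotes the point $$\mathbf z[\sigma,\phi]=\big[e^{i\sigma}\cos\phi,\ \cos(\phi+\tfrac23\pi),\ \cos(\phi+\tfrac43\pi)\big].$$ A SIC set in $\mathbb{CP}^2$ is a set of nine distinct points, represented by unit vectors $\mathbf z_1,\dots,\mathbf z_9$, which are mutually equidistant: $|\langle\mathbf z_i,\mathbf z_j\rangle|^2=\kappa$ for all $i\neq j$, for some fixed $\kappa\in[0,1)$ (necessarily $\kappa=1/4$). Let $C_1=\{[0,z_2,z_3]:|z_2|=|z_3|\neq0\}$, $C_2=\{[z_1,0,z_3]:|z_1|=|z_3|\ne0\}$, $C_3=\{[z_1,z_2,0]:|z_1|=|z_2|\ne0\}$.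 A midpoint solution is a SIC set in $\mathbb{CP}^2$ consisting of three points in each of $C_1,C_2,C_3$. Two subsets of $\mathbb{CP}^2$ are isometric if one is the image of the other under an isometry of $\mathbb{CP}^2$, i.e. a bijection preserving the distance $d([\mathbf w],[\mathbf z])=2\arccos\big(|\langle\mathbf w,\mathbf z\rangle|/(\|\mathbf w\|\|\mathbf z\|)\big)$; the group of isometries is generated by the action of $SU(3)$ and complex conjugation $[\mathbf z]\mapsto[\overline{\mathbf z}]$. *)

theory Defs
  imports "HOL-Analysis.Analysis"
begin

definition herm :: "complex^3 \<Rightarrow> complex^3 \<Rightarrow> complex" where
  "herm w z = (\<Sum>i\<in>UNIV. cnj (w $ i) * z $ i)"

definition proj_rel :: "complex^3 \<Rightarrow> complex^3 \<Rightarrow> bool" where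
  "proj_rel w z \<longleftrightarrow> w \<noteq> 0 \<and> z \<noteq> 0 \<and> (\<exists>c. z = c *s w)"

lemma part_equivp_proj_rel: "part_equivp proj_rel"
proof (rule part_equivpI)
  have "proj_rel (axis 1 1) (axis 1 1)"
    unfolding proj_rel_def by (auto intro!: exI[of _ 1] simp: axis_eq_0_iff)
  then show "\<exists>x. proj_rel x x" by blast
  show "symp proj_rel"
  proof (rule sympI)
    fix w z assume "proj_rel w z"
    then obtain c where c: "w \<noteq> 0" "z \<noteq> 0" "z = c *s w" by (auto simp: proj_rel_def)
    then have "c \<noteq> 0" by auto
    then have "w = inverse c *s z" using c by (simp add: vector_smult_assoc)
    then show "proj_rel z w" using c(1,2) unfolding proj_rel_def by blast
  qed
  show "transp proj_rel"
    by (rule transpI) (auto simp: proj_rel_def vector_smult_assoc)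
qed

text \<open>The complex projective plane. For \<open>z \<noteq> 0\<close>, \<open>abs_cp2 z\<close> is the point \<open>[z]\<close>;
  \<open>abs_cp2 0\<close> is unspecified.\<close>

quotient_type cp2 = "complex^3" / partial: proj_rel
  by (rule part_equivp_proj_rel)

abbreviation cpoint :: "complex \<Rightarrow> complex \<Rightarrow> complex \<Rightarrow> cp2" where
  "cpoint a b c \<equiv> abs_cp2 (vector [a, b, c])"

lemma abs_cp2_eq_iff:
  assumes "w \<noteq> 0" "z \<noteq> 0"
  shows "abs_cp2 w = abs_cp2 z \<longleftrightarrow> (\<exists>c. z = c *s w)"
proof -
  have "proj_rel w w" "proj_rel z z"
    using assms by (auto simp: proj_rel_def intro!: exI[of _ 1])
  then show ?thesis
    using Quotient_rel[OF Quotient_cp2, of w z] assms by (simp add: proj_rel_def)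
qed

lemma norm_vector_smult: "norm (c *s w) = cmod c * norm w" for w :: "complex^3"
  by (simp add: norm_vec_def norm_mult L2_set_right_distrib)

lemma herm_smult: "herm (a *s w) (b *s z) = cnj a * b * herm w z"
  by (simp add: herm_def sum_distrib_left mult_ac)

lift_definition cp2_dist :: "cp2 \<Rightarrow> cp2 \<Rightarrow> real" is
  "\<lambda>w z. 2 * arccos (cmod (herm w z) / (norm w * norm z))"
proof -
  fix w w' z z' assume "proj_rel w w'" "proj_rel z z'"
  then obtain a b where "w' = a *s w" "z' = b *s z" "w' \<noteq> 0" "z' \<noteq> 0"
    by (auto simp: proj_rel_def)
  moreover from this have "a \<noteq> 0" "b \<noteq> 0" by auto
  ultimately show "2 * arccos (cmod (herm w z) / (norm w * norm z)) =
      2 * arccos (cmod (herm w' z') / (norm w' * norm z'))"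
    by (simp add: herm_smult norm_vector_smult norm_mult)
qed

lemma cp2_dist_abs:
  assumes "w \<noteq> 0" "z \<noteq> 0"
  shows "cp2_dist (abs_cp2 w) (abs_cp2 z) = 2 * arccos (cmod (herm w z) / (norm w * norm z))"
  using assms
  by (intro cp2_dist.abs_eq) (auto simp: proj_rel_def intro!: exI[of _ 1])

definition is_cp2_isometry :: "(cp2 \<Rightarrow> cp2) \<Rightarrow> bool" where
  "is_cp2_isometry f \<longleftrightarrow> bij f \<and> (\<forall>p q. cp2_dist (f p) (f q) = cp2_dist p q)"

definition isometric :: "cp2 set \<Rightarrow> cp2 set \<Rightarrow> bool" where
  "isometric S T \<longleftrightarrow> (\<exists>f. is_cp2_isometry f \<and> f ` S = T)"

definition is_SIC :: "cp2 set \<Rightarrow> bool" where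
  "is_SIC S \<longleftrightarrow> (\<exists>(z :: nat \<Rightarrow> complex^3) (\<kappa> :: real).
     (\<forall>i\<in>{1..9}. norm (z i) = 1) \<and>
     bij_betw (\<lambda>i. abs_cp2 (z i)) {1..9} S \<and>
     0 \<le> \<kappa> \<and> \<kappa> < 1 \<and>
     (\<forall>i\<in>{1..9}. \<forall>j\<in>{1..9}. i \<noteq> j \<longrightarrow> (cmod (herm (z i) (z j)))\<^sup>2 = \<kappa>))"

definition C1 :: "cp2 set" where
  "C1 = {cpoint 0 z2 z3 | z2 z3. cmod z2 = cmod z3 \<and> cmod z3 \<noteq> 0}"

definition C2 :: "cp2 set" where
  "C2 = {cpoint z1 0 z3 | z1 z3. cmod z1 = cmod z3 \<and> cmod z3 \<noteq> 0}"

definition C3 :: "cp2 set" where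
  "C3 = {cpoint z1 z2 0 | z1 z2. cmod z1 = cmod z2 \<and> cmod z2 \<noteq> 0}"

definition midpoint_solution :: "cp2 set \<Rightarrow> bool" where
  "midpoint_solution S \<longleftrightarrow> is_SIC S \<and> S \<subseteq> C1 \<union> C2 \<union> C3 \<and>
     card (S \<inter> C1) = 3 \<and> card (S \<inter> C2) = 3 \<and> card (S \<inter> C3) = 3"

text \<open>The three cosines never vanish simultaneously (\<open>zpt_vector_nonzero\<close>), so the
  representative is a nonzero vector.\<close>

definition zpt :: "real \<Rightarrow> real \<Rightarrow> cp2" where
  "zpt \<sigma> \<phi> = cpoint (exp (\<i> * complex_of_real \<sigma>) * complex_of_real (cos \<phi>))
     (complex_of_real (cos (\<phi> + 2 / 3 * pi))) (complex_of_real (cos (\<phi> + 4 / 3 * pi)))"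

lemma zpt_vector_nonzero:
  "vector [exp (\<i> * complex_of_real \<sigma>) * complex_of_real (cos \<phi>),
     complex_of_real (cos (\<phi> + 2 / 3 * pi)), complex_of_real (cos (\<phi> + 4 / 3 * pi))]
   \<noteq> (0 :: complex^3)"
proof
  assume "vector [exp (\<i> * complex_of_real \<sigma>) * complex_of_real (cos \<phi>),
     complex_of_real (cos (\<phi> + 2 / 3 * pi)), complex_of_real (cos (\<phi> + 4 / 3 * pi))]
   = (0 :: complex^3)"
  then have c: "cos \<phi> = 0" "cos (\<phi> + 2 / 3 * pi) = 0"
    by (simp_all add: vec_eq_iff forall_3)
  have "sin (2 / 3 * pi) > 0" by (rule sin_gt_zero) simp_all
  then have "sin \<phi> = 0" using c by (simp add: cos_add)
  then show False using c(1) sin_cos_squared_add[of \<phi>] by simp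
qed

definition omega :: complex where
  "omega = exp (2 * complex_of_real pi * \<i> / 3)"

end

theory Submission
  imports Defs
begin

text \<open>Every point of \<open>S\<close> other than the two given points of \<open>C1\<close> has the form \<open>[s (x + y), x, y]\<close>
  with \<open>|s| = 1\<close> and \<open>x, y\<close> real, and distances between two such points depend on the phases only
  through \<open>Re (cnj s t)\<close>. Two points with the same \<open>(x, y)\<close> and different phases therefore confine
  the other five points to two complex lines (or \<open>[0, 1, -1]\<close> lies in \<open>S\<close>), so that three points of
  \<open>S\<close> are collinear. Three equidistant points on a complex line lie on a great circle and are moved
  by a unitary map to \<open>[0, 1, -\<omega>\<^sup>k]\<close>; equidistance from these three points forces the other six into
  \<open>C2\<close> and \<open>C3\<close>, each of which contains at most three of them.\<close>

section \<open>Coordinates, the Hermitian product and the cube root of unity\<close>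

lemma vec3_eta: "vector [v $ 1, v $ 2, v $ 3] = (v :: 'a::zero ^ 3)"
  by (simp add: vec_eq_iff forall_3)

lemma vec3_eq_0_iff: "vector [a, b, c] = (0 :: 'a::zero ^ 3) \<longleftrightarrow> a = 0 \<and> b = 0 \<and> c = 0"
  by (simp add: vec_eq_iff forall_3)

lemma smult_vec3: "k *s vector [a, b, c] = (vector [k * a, k * b, k * c] :: complex^3)"
  by (simp add: vec_eq_iff forall_3)

lemma herm_vec3:
  "herm (vector [a, b, c]) (vector [d, e, f]) = cnj a * d + cnj b * e + cnj c * f"
  by (simp add: herm_def sum_3)

lemma norm_vec3_square:
  "(norm (vector [a, b, c] :: complex^3))\<^sup>2 = (cmod a)\<^sup>2 + (cmod b)\<^sup>2 + (cmod c)\<^sup>2"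
  by (simp add: norm_vec_def L2_set_def sum_3)

lemma herm_self: "herm v v = of_real ((norm v)\<^sup>2)"
  by (simp add: herm_def norm_vec_def L2_set_def sum_nonneg mult.commute[of "cnj _"] flip: complex_norm_square)

lemma herm_add_left: "herm (u + v) w = herm u w + herm v w"
  and herm_add_right: "herm w (u + v) = herm w u + herm w v"
  and herm_diff_left: "herm (u - v) w = herm u w - herm v w"
  and herm_diff_right: "herm w (u - v) = herm w u - herm w v"
  by (simp_all add: herm_def sum_3 algebra_simps)

lemma herm_smult_left: "herm (a *s u) w = cnj a * herm u w"
  and herm_smult_right: "herm w (a *s u) = a * herm w u"
  using herm_smult[of a u 1 w] herm_smult[of 1 w a u] by simp_all

lemma cnj_herm: "cnj (herm u v) = herm v u"
  by (simp add: herm_def sum_3 mult.commute)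

lemma omega_eq: "omega = Complex (- 1 / 2) (sqrt 3 / 2)"
proof -
  have "omega = cis (2 * pi / 3)"
    by (simp add: omega_def cis_conv_exp mult_ac)
  then show ?thesis
    by (simp add: complex_eq_iff cos_120 sin_120)
qed

lemma omega_square: "omega\<^sup>2 = Complex (- 1 / 2) (- sqrt 3 / 2)"
  by (simp add: omega_eq complex_eq_iff power2_eq_square)

lemma cnj_omega: "cnj omega = omega\<^sup>2"
  by (simp only: omega_square) (simp add: omega_eq complex_eq_iff)

lemma omega_cubed: "omega ^ 3 = 1"
  by (simp add: omega_eq complex_eq_iff power3_eq_cube)

lemma omega_sum: "1 + omega + omega\<^sup>2 = 0"
  by (simp only: omega_square) (simp add: omega_eq complex_eq_iff)

lemma omega_neq: "omega \<noteq> 1" "omega\<^sup>2 \<noteq> 1" "omega\<^sup>2 \<noteq> omega" "omega \<noteq> 0"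
  by (simp_all only: omega_square) (simp_all add: omega_eq complex_eq_iff)

section \<open>Unitary matrices acting on the projective plane\<close>

lemma abs_cp2_rep:
  obtains v where "v \<noteq> 0" "p = abs_cp2 v"
proof -
  have "proj_rel (rep_cp2 p) (rep_cp2 p)" "abs_cp2 (rep_cp2 p) = p"
    using Quotient_rep_reflp[OF Quotient_cp2] Quotient_abs_rep[OF Quotient_cp2] by auto
  then show ?thesis using that[of "rep_cp2 p"] by (auto simp: proj_rel_def)
qed

lemma abs_cp2_smult: "k \<noteq> 0 \<Longrightarrow> v \<noteq> 0 \<Longrightarrow> abs_cp2 (k *s v) = abs_cp2 v"
  by (subst eq_commute, subst abs_cp2_eq_iff) auto

definition conj_transpose :: "complex^3^3 \<Rightarrow> complex^3^3" where
  "conj_transpose A = (\<chi> i j. cnj (A $ j $ i))"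

lemma herm_conj_transpose: "herm (A *v x) y = herm x (conj_transpose A *v y)"
  by (simp add: herm_def conj_transpose_def matrix_vector_mult_def sum_3 algebra_simps)

definition unitary :: "complex^3^3 \<Rightarrow> bool" where
  "unitary A \<longleftrightarrow> conj_transpose A ** A = mat 1"

lemma unitary_herm: "unitary A \<Longrightarrow> herm (A *v x) (A *v y) = herm x y"
  by (simp add: unitary_def herm_conj_transpose matrix_vector_mul_assoc)

lemma unitary_norm: "unitary A \<Longrightarrow> norm (A *v x) = norm x"
  using unitary_herm[of A x x] by (simp add: herm_self flip: of_real_power)

lemma unitary_eq_0_iff: "unitary A \<Longrightarrow> A *v x = 0 \<longleftrightarrow> x = 0"
  using unitary_norm[of A x] by auto

lemma matrix_vector_mult_smult: "A *v (k *s x) = k *s (A *v x)" for A :: "complex^3^3"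
  by (simp add: vec_eq_iff matrix_vector_mult_def sum_3 algebra_simps)

text \<open>\<open>F\<close> applies \<open>A\<close> to a chosen representative; any other
  representative differs by a nonzero scalar, which \<open>A\<close> carries through. Injectivity
  comes from linearity and \<open>unitary_eq_0_iff\<close>; the conjugate transpose supplies
  preimages.\<close>

lemma unitary_induces_isometry:
  assumes A: "unitary A"
  obtains F where "is_cp2_isometry F" "\<And>v. v \<noteq> 0 \<Longrightarrow> F (abs_cp2 v) = abs_cp2 (A *v v)"
proof -
  define F where "F p = abs_cp2 (A *v (SOME v. v \<noteq> 0 \<and> p = abs_cp2 v))" for p
  have F: "F (abs_cp2 v) = abs_cp2 (A *v v)" if v: "v \<noteq> 0" for v
  proof -
    define w where "w = (SOME w. w \<noteq> 0 \<and> abs_cp2 v = abs_cp2 w)"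
    have w: "w \<noteq> 0 \<and> abs_cp2 v = abs_cp2 w"
      unfolding w_def by (rule someI[of _ v]) (use v in auto)
    then obtain c where c: "w = c *s v" using v by (auto simp: abs_cp2_eq_iff)
    then have "abs_cp2 (A *v w) = abs_cp2 (A *v v)"
      using w v A by (cases "c = 0")
        (auto simp: matrix_vector_mult_smult unitary_eq_0_iff intro!: abs_cp2_smult)
    then show ?thesis by (simp add: F_def w_def)
  qed
  have dist: "cp2_dist (F p) (F q) = cp2_dist p q" for p q
  proof -
    obtain v w where "v \<noteq> 0" "p = abs_cp2 v" "w \<noteq> 0" "q = abs_cp2 w"
      by (metis abs_cp2_rep)
    then show ?thesis
      using A by (simp add: F cp2_dist_abs unitary_eq_0_iff unitary_norm unitary_herm)
  qed
  have "inj F"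
  proof (rule injI)
    fix p q assume eq: "F p = F q"
    obtain v w where vw: "v \<noteq> 0" "p = abs_cp2 v" "w \<noteq> 0" "q = abs_cp2 w"
      by (metis abs_cp2_rep)
    then obtain c where "A *v w = c *s (A *v v)"
      using eq A by (auto simp: F abs_cp2_eq_iff unitary_eq_0_iff)
    then have "A *v (w - c *s v) = 0"
      by (simp add: matrix_vector_mult_diff_distrib matrix_vector_mult_smult)
    then have "w = c *s v" using A by (simp add: unitary_eq_0_iff)
    then show "p = q" using vw by (auto simp: abs_cp2_eq_iff)
  qed
  moreover have "surj F"
  proof (rule surjI)
    fix p
    obtain v where v: "v \<noteq> 0" "p = abs_cp2 v" by (rule abs_cp2_rep)
    have inv: "A *v (conj_transpose A *v v) = v"
      using A by (simp add: unitary_def matrix_left_right_inverse matrix_vector_mul_assoc)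
    then have "conj_transpose A *v v \<noteq> 0" using v by auto
    then have "F (abs_cp2 (conj_transpose A *v v)) = p"
      using v inv by (simp add: F)
    then show "F (SOME q. F q = p) = p" by (rule someI)
  qed
  ultimately have "is_cp2_isometry F"
    using dist by (simp add: is_cp2_isometry_def bij_def)
  then show ?thesis using F that by blast
qed

text \<open>\<open>is_SIC\<close> speaks of unit representatives, so the matrix behind
  \<open>F\<close> is kept at hand: it transports the nine vectors with their norms and products,
  and the same \<kappa> serves.\<close>

lemma is_SIC_unitary_image:
  assumes S: "is_SIC S" and A: "unitary A"
    and F: "is_cp2_isometry F" "\<And>v. v \<noteq> 0 \<Longrightarrow> F (abs_cp2 v) = abs_cp2 (A *v v)"
  shows "is_SIC (F ` S)"
proof -
  obtain z \<kappa> where z: "\<And>i. i \<in> {1..9::nat} \<Longrightarrow> norm (z i) = 1"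
      "bij_betw (\<lambda>i. abs_cp2 (z i)) {1..9} S" "0 \<le> \<kappa>" "\<kappa> < 1"
      "\<forall>i\<in>{1..9}. \<forall>j\<in>{1..9}. i \<noteq> j \<longrightarrow> (cmod (herm (z i) (z j)))\<^sup>2 = \<kappa>"
    using S unfolding is_SIC_def by blast
  have "inj F" using F(1) by (simp add: is_cp2_isometry_def bij_def)
  then have "bij_betw F S (F ` S)" by (auto simp: bij_betw_def intro: inj_on_subset)
  with z(2) have bij: "bij_betw (F \<circ> (\<lambda>i. abs_cp2 (z i))) {1..9} (F ` S)"
    by (rule bij_betw_trans)
  have F_z: "(F \<circ> (\<lambda>i. abs_cp2 (z i))) i = abs_cp2 (A *v z i)" if "i \<in> {1..9}" for i
    using F(2)[of "z i"] z(1)[OF that] norm_zero[where 'a = "complex^3"] unfolding comp_apply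
    by (metis zero_neq_one)
  have "bij_betw (\<lambda>i. abs_cp2 (A *v z i)) {1..9} (F ` S)"
    by (rule bij_betw_cong[THEN iffD1, rotated, OF bij]) (rule F_z)
  moreover have "\<forall>i\<in>{1..9}. norm (A *v z i) = 1"
    using z(1) unitary_norm[OF A] by metis
  moreover have "\<forall>i\<in>{1..9}. \<forall>j\<in>{1..9}. i \<noteq> j \<longrightarrow> (cmod (herm (A *v z i) (A *v z j)))\<^sup>2 = \<kappa>"
    using z(5) unfolding unitary_herm[OF A] .
  ultimately show ?thesis
    unfolding is_SIC_def using z(3,4)
    by (intro exI[of _ "\<lambda>i. A *v z i"] exI[of _ \<kappa>] conjI)
qed

section \<open>Overlaps in a SIC set containing the two given points\<close>

text \<open>The SIC condition for \<kappa> = 1/4 in homogeneous form: both sides scale alike, so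
  unnormalised representatives can be used throughout.\<close>

definition quarter_overlaps :: "cp2 set \<Rightarrow> bool" where
  "quarter_overlaps S \<longleftrightarrow> (\<forall>v w. v \<noteq> 0 \<longrightarrow> w \<noteq> 0 \<longrightarrow> abs_cp2 v \<in> S \<longrightarrow> abs_cp2 w \<in> S \<longrightarrow>
     abs_cp2 v \<noteq> abs_cp2 w \<longrightarrow> 4 * (cmod (herm v w))\<^sup>2 = (norm v)\<^sup>2 * (norm w)\<^sup>2)"

lemma quarter_overlapsD:
  assumes "quarter_overlaps S" "v \<noteq> 0" "w \<noteq> 0" "abs_cp2 v \<in> S" "abs_cp2 w \<in> S"
    "abs_cp2 v \<noteq> abs_cp2 w"
  shows "4 * (cmod (herm v w))\<^sup>2 = (norm v)\<^sup>2 * (norm w)\<^sup>2"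
  using assms unfolding quarter_overlaps_def by blast

lemma is_SIC_card: "is_SIC S \<Longrightarrow> card S = 9"
  by (auto simp only: is_SIC_def card_atLeastAtMost dest!: bij_betw_same_card)

lemma is_SIC_overlap:
  assumes "is_SIC S"
  obtains \<kappa> where "\<And>v w. v \<noteq> 0 \<Longrightarrow> w \<noteq> 0 \<Longrightarrow> abs_cp2 v \<in> S \<Longrightarrow> abs_cp2 w \<in> S \<Longrightarrow>
     abs_cp2 v \<noteq> abs_cp2 w \<Longrightarrow> (cmod (herm v w))\<^sup>2 = \<kappa> * ((norm v)\<^sup>2 * (norm w)\<^sup>2)"
proof -
  obtain z \<kappa> where z: "\<And>i. i \<in> {1..9::nat} \<Longrightarrow> norm (z i) = 1"
      "bij_betw (\<lambda>i. abs_cp2 (z i)) {1..9} S"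
      "0 \<le> \<kappa>" "\<kappa> < 1"
      "\<forall>i\<in>{1..9}. \<forall>j\<in>{1..9}. i \<noteq> j \<longrightarrow> (cmod (herm (z i) (z j)))\<^sup>2 = \<kappa>"
    using assms unfolding is_SIC_def by blast
  have rep: "\<exists>i\<in>{1..9}. \<exists>c. abs_cp2 v = abs_cp2 (z i) \<and> v = c *s z i"
    if v: "v \<noteq> 0" "abs_cp2 v \<in> S" for v
  proof -
    obtain i where i: "i \<in> {1..9}" "abs_cp2 (z i) = abs_cp2 v"
      using bij_betw_imp_surj_on[OF z(2)] v(2) by (metis imageE)
    have "z i \<noteq> 0" using z(1)[OF i(1)] norm_zero by fastforce
    then show ?thesis using i v(1) abs_cp2_eq_iff[of "z i" v] by metis
  qed
  have "(cmod (herm v w))\<^sup>2 = \<kappa> * ((norm v)\<^sup>2 * (norm w)\<^sup>2)"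
    if vw: "v \<noteq> 0" "w \<noteq> 0" "abs_cp2 v \<in> S" "abs_cp2 w \<in> S" "abs_cp2 v \<noteq> abs_cp2 w" for v w
  proof -
    obtain i c where i: "i \<in> {1..9}" "abs_cp2 v = abs_cp2 (z i)" "v = c *s z i"
      using rep[of v] vw by blast
    obtain j d where j: "j \<in> {1..9}" "abs_cp2 w = abs_cp2 (z j)" "w = d *s z j"
      using rep[of w] vw by blast
    have "(cmod (herm (z i) (z j)))\<^sup>2 = \<kappa>" using z(5) i j vw by metis
    then show ?thesis
      using z(1)[OF i(1)] z(1)[OF j(1)] i(3) j(3)
      by (simp add: herm_smult norm_mult norm_vector_smult power_mult_distrib)
  qed
  then show ?thesis using that by blast
qed

abbreviation (input) "p1 \<equiv> cpoint 0 1 (- omega)"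
abbreviation (input) "p2 \<equiv> cpoint 0 1 (- (omega ^ 2))"
abbreviation (input) "p3 \<equiv> cpoint 0 1 (- 1)"

lemma cpoint_eq_iff:
  assumes "vector [a, b, c] \<noteq> (0 :: complex^3)" "vector [a', b', c'] \<noteq> (0 :: complex^3)"
  shows "cpoint a b c = cpoint a' b' c' \<longleftrightarrow> (\<exists>k. a' = k * a \<and> b' = k * b \<and> c' = k * c)"
  using assms by (simp add: abs_cp2_eq_iff smult_vec3) (simp add: vec_eq_iff forall_3)

lemma p_distinct: "p1 \<noteq> p2" "p1 \<noteq> p3" "p2 \<noteq> p3"
  using omega_neq by (auto simp: cpoint_eq_iff vec3_eq_0_iff)

lemma cmod_omega: "cmod omega = 1"
  by (simp add: omega_def norm_exp_eq_Re)

text \<open>The two given points already fix \<kappa>: their vectors have squared norm 2, and their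
  product \<open>1 + cnj omega * omega^2 = - omega^2\<close> has modulus 1.\<close>

lemma is_SIC_quarter:
  assumes S: "is_SIC S" and "p1 \<in> S" "p2 \<in> S"
  shows "quarter_overlaps S"
proof -
  obtain \<kappa> where \<kappa>: "\<And>v w. v \<noteq> 0 \<Longrightarrow> w \<noteq> 0 \<Longrightarrow> abs_cp2 v \<in> S \<Longrightarrow> abs_cp2 w \<in> S \<Longrightarrow>
     abs_cp2 v \<noteq> abs_cp2 w \<Longrightarrow> (cmod (herm v w))\<^sup>2 = \<kappa> * ((norm v)\<^sup>2 * (norm w)\<^sup>2)"
    using is_SIC_overlap[OF S] by blast
  have "1 + cnj omega * omega\<^sup>2 = - omega\<^sup>2"
    using omega_sum omega_cubed unfolding cnj_omega by algebra
  then have "cmod (1 + cnj omega * omega\<^sup>2) = 1"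
    by (simp add: norm_power cmod_omega)
  then have "\<kappa> = 1 / 4"
    using \<kappa>[of "vector [0, 1, - omega]" "vector [0, 1, - (omega\<^sup>2)]"] assms p_distinct
    by (simp add: herm_vec3 norm_vec3_square vec3_eq_0_iff cmod_omega norm_power)
  then show ?thesis using \<kappa> by (simp add: quarter_overlaps_def)
qed


section \<open>Normal form of the remaining points and their mutual overlaps\<close>

lemma cmod_diff_unit_square:
  assumes "cmod \<zeta> = 1"
  shows "(cmod (b - \<zeta> * c))\<^sup>2 = (cmod b)\<^sup>2 + (cmod c)\<^sup>2 - 2 * Re (\<zeta> * (cnj b * c))"
proof -
  have "(Re \<zeta>)\<^sup>2 + (Im \<zeta>)\<^sup>2 = 1" using assms by (simp add: cmod_def)
  then show ?thesis unfolding cmod_power2 by simp algebra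
qed

lemma overlap_with_C1_point:
  assumes S: "quarter_overlaps S" and \<zeta>: "cmod \<zeta> = 1" "cpoint 0 1 (- \<zeta>) \<in> S"
    and v: "vector [a, b, c] \<noteq> (0 :: complex^3)" "cpoint a b c \<in> S"
      "cpoint a b c \<noteq> cpoint 0 1 (- \<zeta>)"
  shows "(cmod a)\<^sup>2 = (cmod b)\<^sup>2 + (cmod c)\<^sup>2 - 4 * Re (cnj \<zeta> * (cnj b * c))"
proof -
  have "4 * (cmod (b - cnj \<zeta> * c))\<^sup>2 = 2 * ((cmod a)\<^sup>2 + (cmod b)\<^sup>2 + (cmod c)\<^sup>2)"
    using quarter_overlapsD[OF S _ v(1) \<zeta>(2) v(2) v(3)[symmetric]] \<zeta>(1)
    by (simp add: herm_vec3 norm_vec3_square vec3_eq_0_iff)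
  then show ?thesis
    using cmod_diff_unit_square[of "cnj \<zeta>" b c] \<zeta>(1) by simp
qed

text \<open>The values \<open>omega\<close> and \<open>omega^2\<close> of \<zeta> are conjugate, so
  the two instances of \<open>overlap_with_C1_point\<close> differ only in the sign of the
  \<open>Im (cnj b * c)\<close> term. Subtracting removes it, and \<open>Re omega = - 1/2\<close>
  turns the factor -4 into +2.\<close>

lemma overlap_with_p1_p2:
  assumes S: "quarter_overlaps S" "p1 \<in> S" "p2 \<in> S"
    and v: "vector [a, b, c] \<noteq> (0 :: complex^3)" "cpoint a b c \<in> S"
      "cpoint a b c \<noteq> p1" "cpoint a b c \<noteq> p2"
  shows "Im (cnj b * c) = 0" "(cmod a)\<^sup>2 = (cmod b)\<^sup>2 + (cmod c)\<^sup>2 + 2 * Re (cnj b * c)"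
proof -
  have eq: "(cmod a)\<^sup>2 = (cmod b)\<^sup>2 + (cmod c)\<^sup>2 - 4 * Re (cnj omega * (cnj b * c))"
    "(cmod a)\<^sup>2 = (cmod b)\<^sup>2 + (cmod c)\<^sup>2 - 4 * Re (cnj (omega\<^sup>2) * (cnj b * c))"
    using overlap_with_C1_point[OF S(1) _ S(2) v(1,2,3)]
      overlap_with_C1_point[OF S(1) _ S(3) v(1,2,4)] cmod_omega
    by (simp_all only: norm_power power_one)
  have re: "Re (cnj omega * u) = - Re u / 2 + sqrt 3 / 2 * Im u"
    "Re (cnj (omega\<^sup>2) * u) = - Re u / 2 - sqrt 3 / 2 * Im u" for u
    by (simp_all only: omega_square) (simp_all add: omega_eq)
  define u where "u = cnj b * c"
  have "sqrt 3 * Im u = 0"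
    using eq unfolding re u_def[symmetric] by (simp add: field_simps)
  then have "Im u = 0" by simp
  then show "Im (cnj b * c) = 0" "(cmod a)\<^sup>2 = (cmod b)\<^sup>2 + (cmod c)\<^sup>2 + 2 * Re (cnj b * c)"
    using eq(1) unfolding re u_def[symmetric] by simp_all
qed

text \<open>For real \<open>b = x\<close> and \<open>c = y\<close>,
  \<open>overlap_with_p1_p2\<close> reads \<open>|a|^2 = (x + y)^2\<close>, which leaves only a
  phase \<open>s\<close> free in the first coordinate.\<close>

abbreviation rpoint :: "complex \<Rightarrow> real \<Rightarrow> real \<Rightarrow> cp2" where
  "rpoint s x y \<equiv> cpoint (s * of_real (x + y)) (of_real x) (of_real y)"

text \<open>Since \<open>cnj b * c\<close> is real, scaling the representative by
  \<open>cnj b\<close> (by \<open>cnj c\<close> if \<open>b = 0\<close>) makes the last two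
  coordinates real.\<close>

lemma SIC_point_eq_rpoint:
  assumes S: "quarter_overlaps S" "p1 \<in> S" "p2 \<in> S" and p: "p \<in> S" "p \<noteq> p1" "p \<noteq> p2"
  obtains s x y where "cmod s = 1" "x \<noteq> 0 \<or> y \<noteq> 0" "p = rpoint s x y"
proof -
  obtain v where "v \<noteq> 0" "p = abs_cp2 v" by (rule abs_cp2_rep)
  then obtain a b c where v: "vector [a, b, c] \<noteq> (0 :: complex^3)" "p = cpoint a b c"
    by (metis vec3_eta)
  have eq: "Im (cnj b * c) = 0" "(cmod a)\<^sup>2 = (cmod b)\<^sup>2 + (cmod c)\<^sup>2 + 2 * Re (cnj b * c)"
    using overlap_with_p1_p2[OF S v(1)] p v(2) by metis+
  \<comment> \<open>For \<open>r = 0\<close> the phase is undetermined and 1 is chosen.\<close>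
  have phase: "\<exists>s. cmod s = 1 \<and> a' = s * of_real r" if "cmod a' = \<bar>r\<bar>" for a' r
  proof (cases "r = 0")
    case True
    then show ?thesis using that by (intro exI[of _ 1]) simp
  next
    case False
    then show ?thesis using that by (intro exI[of _ "a' / of_real r"]) (simp add: norm_divide)
  qed
  show ?thesis
  proof (cases "b = 0")
    case False
    define x y where "x = (cmod b)\<^sup>2" and "y = Re (cnj b * c)"
    have y: "cnj b * c = of_real y" using eq(1) by (simp add: y_def complex_eq_iff)
    have x: "cnj b * b = of_real x" by (simp add: x_def mult.commute flip: complex_norm_square)
    \<comment> \<open>This turns \<open>|b|^2 * (|b|^2 + |c|^2 + 2 y)\<close> into the perfect
      square \<open>(x + y)^2\<close>.\<close>
    have "y\<^sup>2 = x * (cmod c)\<^sup>2"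
      using arg_cong[OF y, of "\<lambda>z. (cmod z)\<^sup>2"] by (simp add: x_def norm_mult power_mult_distrib)
    then have "(cmod (cnj b * a))\<^sup>2 = (x + y)\<^sup>2"
      using eq(2) unfolding y_def[symmetric] x_def[symmetric] norm_mult power_mult_distrib complex_mod_cnj
      by algebra
    then have "cmod (cnj b * a) = \<bar>x + y\<bar>"
      by (metis abs_norm_cancel power2_abs power2_eq_iff_nonneg abs_ge_zero)
    then obtain s where s: "cmod s = 1" "cnj b * a = s * of_real (x + y)" using phase by blast
    have "p = abs_cp2 (cnj b *s vector [a, b, c])"
      using v False by (subst abs_cp2_smult) auto
    also have "\<dots> = rpoint s x y" unfolding smult_vec3 using s x y by simp
    finally show ?thesis using that[OF s(1), of x y] False by (auto simp: x_def)
  next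
    case True
    define y where "y = (cmod c)\<^sup>2"
    have ac: "cmod a = cmod c" using eq(2) True by simp
    then have c: "c \<noteq> 0" using v(1) True by (auto simp: vec3_eq_0_iff)
    have "cmod (cnj c * a) = \<bar>0 + y\<bar>" using ac by (simp add: norm_mult y_def power2_eq_square)
    then obtain s where s: "cmod s = 1" "cnj c * a = s * of_real (0 + y)" using phase by blast
    have "p = abs_cp2 (cnj c *s vector [a, b, c])"
      using v c by (subst abs_cp2_smult) auto
    also have "\<dots> = rpoint s 0 y"
      unfolding smult_vec3 using s True
      by (simp add: y_def mult.commute[of "cnj c" c] flip: complex_norm_square)
    finally show ?thesis using that[OF s(1), of 0 y] c by (auto simp: y_def)
  qed
qed

lemma rpoint_nonzero: "x \<noteq> 0 \<or> y \<noteq> 0 \<Longrightarrow> vector [z, of_real x, of_real y] \<noteq> (0 :: complex^3)"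
  by (auto simp: vec3_eq_0_iff)

text \<open>The Hermitian product is \<open>g X + Y\<close> with \<open>g = cnj s * t\<close> of
  modulus 1, so phases enter only through \<open>Re g\<close>. Each squared norm is
  \<open>2 (x^2 + x y + y^2)\<close>, and the two factors 2 cancel the 4 of
  \<open>quarter_overlaps\<close>.\<close>

lemma rpoint_overlap:
  assumes S: "quarter_overlaps S"
    and p: "cmod s = 1" "x \<noteq> 0 \<or> y \<noteq> 0" "rpoint s x y \<in> S"
    and q: "cmod t = 1" "x' \<noteq> 0 \<or> y' \<noteq> 0" "rpoint t x' y' \<in> S"
    and neq: "rpoint s x y \<noteq> rpoint t x' y'"
  defines "X \<equiv> (x + y) * (x' + y')" and "Y \<equiv> x * x' + y * y'"
  shows "X\<^sup>2 + Y\<^sup>2 + 2 * X * Y * Re (cnj s * t) = (x\<^sup>2 + x * y + y\<^sup>2) * (x'\<^sup>2 + x' * y' + y'\<^sup>2)"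
proof -
  define g where "g = cnj s * t"
  have "cmod g = 1" using p q by (simp add: g_def norm_mult)
  then have g: "(Re g)\<^sup>2 + (Im g)\<^sup>2 = 1" by (simp add: cmod_def)
  have "cnj (s * of_real (x + y)) * (t * of_real (x' + y')) + cnj (of_real x) * of_real x' +
      cnj (of_real y) * of_real y' = g * of_real X + of_real Y"
    by (simp add: g_def X_def Y_def algebra_simps)
  then have "4 * (cmod (g * of_real X + of_real Y))\<^sup>2 =
      ((x + y)\<^sup>2 + x\<^sup>2 + y\<^sup>2) * ((x' + y')\<^sup>2 + x'\<^sup>2 + y'\<^sup>2)"
    using quarter_overlapsD[OF S rpoint_nonzero[OF p(2)] rpoint_nonzero[OF q(2)] p(3) q(3) neq]
    unfolding herm_vec3 norm_vec3_square norm_mult norm_of_real p(1) q(1) by simp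
  moreover have "(cmod (g * of_real X + of_real Y))\<^sup>2 = X\<^sup>2 + Y\<^sup>2 + 2 * X * Y * Re g"
    unfolding cmod_power2 using g by simp algebra
  ultimately show ?thesis
    unfolding g_def[symmetric] by (simp add: power2_eq_square algebra_simps)
qed

text \<open>Equal real parts put \<open>r\<close> at equal distance from \<open>s\<close> and
  \<open>t\<close> on the unit circle, so \<open>r\<close> is one of the two midpoints of the arcs
  between them.\<close>

lemma unit_square_eq_mult:
  assumes unit: "cmod r = 1" "cmod s = 1" "cmod t = 1" and "s \<noteq> t"
    and re: "Re (cnj s * r) = Re (cnj t * r)"
  shows "r\<^sup>2 = s * t"
proof -
  have u: "cnj z * z = 1" if "cmod z = 1" for z
    using that complex_norm_square[of z] by (simp add: mult.commute)
  have "(cnj s * r - cnj t * r) + cnj (cnj s * r - cnj t * r) = 0"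
    using re by (simp add: complex_eq_iff)
  then have "(cnj s - cnj t) * r + (s - t) * cnj r = 0" by (simp add: algebra_simps)
  \<comment> \<open>The previous equation multiplied by \<open>s * t * r\<close>, with
    \<open>cnj z * z = 1\<close> for each of the three.\<close>
  then have "(t - s) * (r\<^sup>2 - s * t) = 0"
    using u[OF unit(1)] u[OF unit(2)] u[OF unit(3)] by algebra
  then show ?thesis using \<open>s \<noteq> t\<close> by simp
qed


section \<open>Three collinear points in the SIC set\<close>

text \<open>For \<open>w \<noteq> 0\<close> this is the complex projective line with pole
  \<open>w\<close>; for \<open>w = 0\<close> it is the whole plane, so later statements carry
  \<open>w \<noteq> 0\<close>.\<close>

definition line :: "complex^3 \<Rightarrow> cp2 set" where
  "line w = {abs_cp2 v |v. v \<noteq> 0 \<and> herm w v = 0}"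

lemma abs_cp2_in_line: "v \<noteq> 0 \<Longrightarrow> herm w v = 0 \<Longrightarrow> abs_cp2 v \<in> line w"
  by (auto simp: line_def)

lemma three_in_one_of_two:
  assumes "5 \<le> card F" "F \<subseteq> A \<union> B"
  shows "3 \<le> card (F \<inter> A) \<or> 3 \<le> card (F \<inter> B)"
proof -
  have "F = (F \<inter> A) \<union> (F \<inter> B)" using assms(2) by blast
  then have "card F \<le> card (F \<inter> A) + card (F \<inter> B)" by (metis card_Un_le)
  then show ?thesis using assms(1) by linarith
qed

text \<open>A fixed phase amounts to the linear equation \<open>z1 = s (z2 + z3)\<close>, so
  bounding the number of phases bounds the number of lines.\<close>

lemma rpoint_in_line_phase: "x \<noteq> 0 \<or> y \<noteq> 0 \<Longrightarrow> rpoint s x y \<in> line (vector [1, - cnj s, - cnj s])"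
  by (rule abs_cp2_in_line[OF rpoint_nonzero]) (simp_all add: herm_vec3 algebra_simps)

lemma rpoint_in_line_real:
  assumes "x' \<noteq> 0 \<or> y' \<noteq> 0" "x * x' + y * y' = 0"
  shows "rpoint s x' y' \<in> line (vector [0, of_real x, of_real y])"
proof (rule abs_cp2_in_line[OF rpoint_nonzero[OF assms(1)]])
  show "herm (vector [0, of_real x, of_real y]) (vector [s * of_real (x' + y'), of_real x', of_real y']) = 0"
    unfolding herm_vec3 using assms(2) by (simp flip: of_real_mult of_real_add)
qed

text \<open>Here the first coordinate vanishes and the phase carries no information; this point has
  to be treated separately.\<close>

lemma rpoint_eq_p3: "x \<noteq> 0 \<or> y \<noteq> 0 \<Longrightarrow> x + y = 0 \<Longrightarrow> rpoint s x y = p3"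
proof -
  assume *: "x \<noteq> 0 \<or> y \<noteq> 0" "x + y = 0"
  then have "y = - x" "x \<noteq> 0" by auto
  then show "rpoint s x y = p3"
    by (subst eq_commute) (auto simp: cpoint_eq_iff vec3_eq_0_iff)
qed

text \<open>If \<open>x y \<noteq> 0\<close>, equidistance from the two given points makes the phase of any further point
  one of the two square roots of \<open>s t\<close>; if \<open>x y = 0\<close>, it may also lie on the line orthogonal to
  \<open>[0, x, y]\<close>, but then only one of the square roots is possible.\<close>

lemma SIC_collinear_triple:
  assumes SIC: "is_SIC S" and S: "p1 \<in> S" "p2 \<in> S"
    and st: "cmod s = 1" "cmod t = 1" and "x + y \<noteq> 0"
    and z: "rpoint s x y \<in> S" "rpoint t x y \<in> S" "rpoint s x y \<noteq> rpoint t x y"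
  obtains w where "w \<noteq> 0" "3 \<le> card (S \<inter> line w)"
proof -
  have q: "quarter_overlaps S" using is_SIC_quarter[OF SIC S] .
  have card: "card S = 9" using is_SIC_card[OF SIC] .
  then have fin: "finite S" by (metis card.infinite zero_neq_numeral)
  have xy: "x \<noteq> 0 \<or> y \<noteq> 0" using \<open>x + y \<noteq> 0\<close> by auto
  have "s \<noteq> t" using z(3) by auto
  show ?thesis
  proof (cases "p3 \<in> S")
    case True
    \<comment> \<open>These three points all lie on the line \<open>z1 = 0\<close>.\<close>
    have "{p1, p2, p3} \<subseteq> line (axis 1 1)"
      by (auto intro!: abs_cp2_in_line simp: vec3_eq_0_iff herm_def sum_3 axis_def)
    then have "{p1, p2, p3} \<subseteq> S \<inter> line (axis 1 1)" using S True by auto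
    then have "card {p1, p2, p3} \<le> card (S \<inter> line (axis 1 1))" using fin by (intro card_mono) auto
    then show ?thesis using that[of "axis 1 1"] p_distinct by (simp add: axis_eq_0_iff)
  next
    case False
    \<comment> \<open>At least 9 - 4 = 5 points remain, so two lines covering them leave three on
      one line.\<close>
    define F where "F = S - {p1, p2, rpoint s x y, rpoint t x y}"
    have "card S - card {p1, p2, rpoint s x y, rpoint t x y} \<le> card F"
      unfolding F_def by (rule diff_card_le_card_Diff) simp
    moreover have "card {p1, p2, rpoint s x y, rpoint t x y} \<le> 4"
      by (simp add: card_insert_if)
    ultimately have F: "5 \<le> card F" using card by linarith
    have two_lines: ?thesis if "w \<noteq> 0" "w' \<noteq> 0" "F \<subseteq> line w \<union> line w'" for w w'
    proof -
      have "card (F \<inter> line u) \<le> card (S \<inter> line u)" for u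
        by (rule card_mono) (use fin in \<open>auto simp: F_def\<close>)
      then show ?thesis
        using three_in_one_of_two[OF F that(3)] that(1,2) \<open>\<And>w. \<lbrakk>w \<noteq> 0; 3 \<le> card (S \<inter> line w)\<rbrakk> \<Longrightarrow> thesis\<close>
        by (meson order_trans)
    qed
    have cases: "\<exists>r. cmod r = 1 \<and> p \<in> line (vector [1, - cnj r, - cnj r]) \<and>
        (p \<in> line (vector [0, of_real x, of_real y]) \<and> x * y = 0 \<or>
         r\<^sup>2 = s * t \<and> (x * y = 0 \<longrightarrow> Re (cnj s * r) = - 1 / 2))" if p: "p \<in> F" for p
    proof -
      have pS: "p \<in> S" "p \<noteq> p1" "p \<noteq> p2" "rpoint s x y \<noteq> p" "rpoint t x y \<noteq> p" "p \<noteq> p3"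
        using p False by (auto simp: F_def)
      obtain r x' y' where r: "cmod r = 1" "x' \<noteq> 0 \<or> y' \<noteq> 0" "p = rpoint r x' y'"
        using SIC_point_eq_rpoint[OF q S pS(1-3)] by blast
      have "x' + y' \<noteq> 0" using rpoint_eq_p3 r pS(6) by blast
      define X Y where "X = (x + y) * (x' + y')" and "Y = x * x' + y * y'"
      have X: "X \<noteq> 0" using \<open>x' + y' \<noteq> 0\<close> \<open>x + y \<noteq> 0\<close> by (simp add: X_def)
      have eq: "X\<^sup>2 + Y\<^sup>2 + 2 * X * Y * Re (cnj u * r) = (x\<^sup>2 + x * y + y\<^sup>2) * (x'\<^sup>2 + x' * y' + y'\<^sup>2)"
        if "u = s \<or> u = t" for u
        unfolding X_def Y_def using that z st r pS xy
        by (intro rpoint_overlap[OF q]) auto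
      show ?thesis
      proof (cases "Y = 0")
        case True
        have "X\<^sup>2 = (x\<^sup>2 + x * y + y\<^sup>2) * (x'\<^sup>2 + x' * y' + y'\<^sup>2)" using eq[of s] True by simp
        \<comment> \<open>\<open>Y = 0\<close> makes \<open>(x', y')\<close> a multiple
          \<open>k (-y, x)\<close>; the two sides of the overlap equation then differ by
          \<open>3 k^2 x^2 y^2\<close>.\<close>
        then have "(x * y)\<^sup>2 * y'\<^sup>2 = 0" "(x * y)\<^sup>2 * x'\<^sup>2 = 0"
          using True unfolding X_def Y_def by algebra+
        then have "x * y = 0" using r(2) by auto
        moreover have "p \<in> line (vector [0, of_real x, of_real y])"
          unfolding r(3) using True by (intro rpoint_in_line_real[OF r(2)]) (simp add: Y_def)
        ultimately show ?thesis using r rpoint_in_line_phase[OF r(2)] by blast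
      next
        case False
        \<comment> \<open>The overlap equations with the two given phases have the same right-hand
          side.\<close>
        have "2 * X * Y * (Re (cnj s * r) - Re (cnj t * r)) = 0"
          using eq[of s] eq[of t] by (simp add: algebra_simps)
        then have "r\<^sup>2 = s * t"
          using unit_square_eq_mult[OF r(1) st \<open>s \<noteq> t\<close>] X False by simp
        moreover have "Re (cnj s * r) = - 1 / 2" if "x * y = 0"
        proof -
          \<comment> \<open>If one of \<open>x\<close>, \<open>y\<close> is zero, then
            \<open>X^2 + Y^2\<close> exceeds the right-hand side of the overlap equation by exactly
            \<open>X Y\<close>.\<close>
          have "X * Y * (1 + 2 * Re (cnj s * r)) = 0"
            using that eq[OF disjI1[OF refl]] unfolding X_def Y_def mult_eq_0_iff[of x y]
            by (elim disjE) algebra+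
          then show ?thesis using X False by (simp add: add_eq_0_iff)
        qed
        ultimately show ?thesis using r rpoint_in_line_phase[OF r(2)] by blast
      qed
    qed
    have nz: "vector [1, b, c] \<noteq> (0 :: complex^3)" for b c by (simp add: vec3_eq_0_iff)
    have real_nz: "vector [0, of_real x, of_real y] \<noteq> (0 :: complex^3)"
      using xy by (rule rpoint_nonzero)
    show ?thesis
    proof (cases "F \<subseteq> line (vector [0, of_real x, of_real y])")
      case True
      then show ?thesis using two_lines[OF real_nz real_nz] by blast
    next
      case False
      then obtain p where p: "p \<in> F" "p \<notin> line (vector [0, of_real x, of_real y])" by blast
      then obtain m where m: "cmod m = 1" "m\<^sup>2 = s * t" "x * y = 0 \<longrightarrow> Re (cnj s * m) = - 1 / 2"
        using cases by blast
      have root: "r = m \<or> r = - m" if "r\<^sup>2 = s * t" for r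
        using that m(2) power2_eq_iff[of r m] by simp
      show ?thesis
      proof (cases "x * y = 0")
        case True
        \<comment> \<open>Replacing \<open>m\<close> by \<open>- m\<close> would change the real
          part to +1/2, so only one root remains beside the line orthogonal to
          \<open>[0, x, y]\<close>.\<close>
        have "r = m" if "r\<^sup>2 = s * t" "Re (cnj s * r) = - 1 / 2" for r
          using root[OF that(1)] that(2) m(3) True by auto
        then have "F \<subseteq> line (vector [1, - cnj m, - cnj m]) \<union> line (vector [0, of_real x, of_real y])"
          using cases True by blast
        then show ?thesis by (rule two_lines[OF nz real_nz])
      next
        case False
        then have "F \<subseteq> line (vector [1, - cnj m, - cnj m]) \<union> line (vector [1, - cnj (- m), - cnj (- m)])"
          using cases root by blast
        then show ?thesis by (rule two_lines[OF nz nz])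
      qed
    qed
  qed
qed


section \<open>From the three points \<open>[0, 1, -omega^k]\<close> to a midpoint solution\<close>

text \<open>Relative to one point of phase \<open>s\<close>, any other has
  \<open>g = cnj s * t\<close> with \<open>|g| = |1 + g| = 1\<close>, so \<open>g\<close> is a
  primitive cube root of unity. \<open>P\<close> is kept abstract to cover both \<open>C2\<close>
  and \<open>C3\<close>.\<close>

lemma card_equidistant_phases_le_3:
  assumes S: "quarter_overlaps S" and P: "\<And>z. P z \<noteq> 0"
    and herm: "\<And>z z'. herm (P z) (P z') = 1 + cnj z * z'"
    and norm: "\<And>z. (norm (P z))\<^sup>2 = 1 + (cmod z)\<^sup>2"
    and A: "A \<subseteq> S" "A \<subseteq> (\<lambda>z. abs_cp2 (P z)) ` {z. cmod z = 1}"
  shows "card A \<le> 3"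
proof (cases "A = {}")
  case False
  then obtain s where s: "cmod s = 1" "abs_cp2 (P s) \<in> A" using A(2) by blast
  have "A \<subseteq> (\<lambda>z. abs_cp2 (P z)) ` {s, s * omega, s * omega\<^sup>2}"
  proof
    fix p assume p: "p \<in> A"
    then obtain t where t: "cmod t = 1" "p = abs_cp2 (P t)" using A(2) by blast
    show "p \<in> (\<lambda>z. abs_cp2 (P z)) ` {s, s * omega, s * omega\<^sup>2}"
    proof (cases "abs_cp2 (P s) = p")
      case False
      define g where "g = cnj s * t"
      have "4 * (cmod (1 + g))\<^sup>2 = 4"
        using quarter_overlapsD[OF S P P, of s t] s t p A(1) False unfolding herm norm g_def by auto
      then have g1: "(cmod (1 + g))\<^sup>2 = 1" by simp
      have g2: "(cmod g)\<^sup>2 = 1" using s t by (simp add: g_def norm_mult)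
      have re: "Re g = - 1 / 2"
        using g1 g2 unfolding cmod_power2 by (simp add: power2_eq_square algebra_simps)
      then have "(Im g)\<^sup>2 = (sqrt 3 / 2)\<^sup>2"
        using g2 unfolding cmod_power2 by (simp add: power2_eq_square)
      then have "Im g = sqrt 3 / 2 \<or> Im g = - (sqrt 3 / 2)" by (simp only: power2_eq_iff)
      then have "g = omega \<or> g = omega\<^sup>2"
        using re by (simp only: omega_square) (auto simp: omega_eq complex_eq_iff)
      moreover have "s * cnj s = 1" using s(1) complex_norm_square[of s] by simp
      then have "t = s * g" by (simp add: g_def flip: mult.assoc)
      ultimately show ?thesis using t(2) by auto
    qed auto
  qed
  then have "card A \<le> card ((\<lambda>z. abs_cp2 (P z)) ` {s, s * omega, s * omega\<^sup>2})"
    by (intro card_mono) auto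
  also have "\<dots> \<le> card {s, s * omega, s * omega\<^sup>2}" by (rule card_image_le) simp
  also have "\<dots> \<le> 3" by (simp add: card_insert_if)
  finally show ?thesis .
qed simp

lemma C2_subset: "C2 \<subseteq> (\<lambda>z. cpoint 1 0 z) ` {z. cmod z = 1}"
proof
  fix p assume "p \<in> C2"
  then obtain a c where ac: "p = cpoint a 0 c" "cmod a = cmod c" "cmod c \<noteq> 0"
    by (auto simp: C2_def)
  then have "a \<noteq> 0" by auto
  then have "cpoint 1 0 (c / a) = p"
    using ac by (auto simp: cpoint_eq_iff vec3_eq_0_iff intro!: exI[of _ a])
  then show "p \<in> (\<lambda>z. cpoint 1 0 z) ` {z. cmod z = 1}"
    using ac by (intro image_eqI[of _ _ "c / a"]) (auto simp: norm_divide)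
qed

lemma C3_subset: "C3 \<subseteq> (\<lambda>z. cpoint 1 z 0) ` {z. cmod z = 1}"
proof
  fix p assume "p \<in> C3"
  then obtain a b where ab: "p = cpoint a b 0" "cmod a = cmod b" "cmod b \<noteq> 0"
    by (auto simp: C3_def)
  then have "a \<noteq> 0" by auto
  then have "cpoint 1 (b / a) 0 = p"
    using ab by (auto simp: cpoint_eq_iff vec3_eq_0_iff intro!: exI[of _ a])
  then show "p \<in> (\<lambda>z. cpoint 1 z 0) ` {z. cmod z = 1}"
    using ab by (intro image_eqI[of _ _ "b / a"]) (auto simp: norm_divide)
qed

lemma card_C2_le: "quarter_overlaps S \<Longrightarrow> card (S \<inter> C2) \<le> 3"
  by (rule card_equidistant_phases_le_3[of S "\<lambda>z. vector [1, 0, z]"])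
    (use C2_subset in \<open>auto simp: herm_vec3 norm_vec3_square vec3_eq_0_iff\<close>)

lemma card_C3_le: "quarter_overlaps S \<Longrightarrow> card (S \<inter> C3) \<le> 3"
  by (rule card_equidistant_phases_le_3[of S "\<lambda>z. vector [1, z, 0]"])
    (use C3_subset in \<open>auto simp: herm_vec3 norm_vec3_square vec3_eq_0_iff\<close>)

lemma C1_disjoint: "C1 \<inter> (C2 \<union> C3) = {}"
  by (auto simp: C1_def C2_def C3_def cpoint_eq_iff vec3_eq_0_iff)

text \<open>The overlap with \<open>p3\<close> has -4 where those with \<open>p1\<close> and
  \<open>p2\<close> together give +2 in front of \<open>Re (cnj b * c)\<close>. Hence
  \<open>cnj b * c = 0\<close>, and every further point lies in \<open>C2\<close> or
  \<open>C3\<close>.\<close>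

lemma SIC_midpoint_solution:
  assumes SIC: "is_SIC S" and S: "p1 \<in> S" "p2 \<in> S" "p3 \<in> S"
  shows "midpoint_solution S"
proof -
  have q: "quarter_overlaps S" using is_SIC_quarter[OF SIC S(1,2)] .
  have card: "card S = 9" using is_SIC_card[OF SIC] .
  then have fin: "finite S" by (metis card.infinite zero_neq_numeral)
  have other: "p \<in> C2 \<union> C3" if p: "p \<in> S" "p \<noteq> p1" "p \<noteq> p2" "p \<noteq> p3" for p
  proof -
    obtain v where "v \<noteq> 0" "p = abs_cp2 v" by (rule abs_cp2_rep)
    then obtain a b c where v: "vector [a, b, c] \<noteq> (0 :: complex^3)" "p = cpoint a b c"
      by (metis vec3_eta)
    have u: "Im (cnj b * c) = 0" "(cmod a)\<^sup>2 = (cmod b)\<^sup>2 + (cmod c)\<^sup>2 + 2 * Re (cnj b * c)"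
      using overlap_with_p1_p2[OF q S(1,2) v(1)] p v(2) by metis+
    moreover have "(cmod a)\<^sup>2 = (cmod b)\<^sup>2 + (cmod c)\<^sup>2 - 4 * Re (cnj b * c)"
      using overlap_with_C1_point[OF q _ S(3) v(1)] p v(2) by simp
    ultimately have "Re (cnj b * c) = 0" by linarith
    with u have "cnj b * c = 0" and "(cmod a)\<^sup>2 = (cmod b)\<^sup>2 + (cmod c)\<^sup>2"
      by (simp_all add: complex_eq_iff)
    then consider "b = 0" "cmod a = cmod c" | "c = 0" "cmod a = cmod b" by auto
    then show ?thesis
    proof cases
      case 1
      then have "cmod c \<noteq> 0" using v(1) by (auto simp: vec3_eq_0_iff)
      then have "p \<in> C2" unfolding C2_def using v(2) 1 by blast
      then show ?thesis by blast
    next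
      case 2
      then have "cmod b \<noteq> 0" using v(1) by (auto simp: vec3_eq_0_iff)
      then have "p \<in> C3" unfolding C3_def using v(2) 2 by blast
      then show ?thesis by blast
    qed
  qed
  have "cpoint 0 1 (- \<zeta>) \<in> C1" if "cmod \<zeta> = 1" for \<zeta>
    unfolding C1_def mem_Collect_eq
    by (rule exI[of _ 1], rule exI[of _ "- \<zeta>"]) (use that in simp)
  then have p_C1: "p1 \<in> C1" "p2 \<in> C1" "p3 \<in> C1"
    using cmod_omega norm_power[of omega 2] by simp_all
  have C1: "S \<inter> C1 = {p1, p2, p3}" using p_C1 S other C1_disjoint by blast
  then have card_C1: "card (S \<inter> C1) = 3" using p_distinct by simp
  have sub: "S \<subseteq> C1 \<union> C2 \<union> C3" using other p_C1 by blast
  then have "S = (S \<inter> C1) \<union> ((S \<inter> C2) \<union> (S \<inter> C3))" by blast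
  \<comment> \<open>Now \<open>9 \<le> 3 + card (S \<inter> C2) + card (S \<inter> C3)\<close>,
    where both cardinalities are at most 3, forces equality.\<close>
  then have "card S \<le> card (S \<inter> C1) + (card (S \<inter> C2) + card (S \<inter> C3))"
    by (metis card_Un_le add_left_mono order_trans)
  then show ?thesis
    unfolding midpoint_solution_def
    using SIC sub card card_C1 card_C2_le[OF q] card_C3_le[OF q] by linarith
qed


section \<open>Moving a collinear triple into standard position\<close>

lemma unitary_orthonormal_rows:
  assumes "\<And>i j. herm (f i) (f j) = (if i = j then 1 else 0)"
  shows "unitary (\<chi> i j. cnj (f i $ j))"
proof -
  have "(\<chi> i j. cnj (f i $ j)) ** conj_transpose (\<chi> i j. cnj (f i $ j)) = mat 1"
    using assms by (simp add: vec_eq_iff matrix_matrix_mult_def conj_transpose_def mat_def herm_def)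
  then show ?thesis by (simp add: unitary_def matrix_left_right_inverse)
qed

lemma unitary_orthonormal_basis:
  assumes "herm f1 f1 = 1" "herm f2 f2 = 1" "herm f3 f3 = 1"
    "herm f1 f2 = 0" "herm f1 f3 = 0" "herm f2 f3 = 0"
  obtains A where "unitary A" "\<And>v. A *v v = vector [herm f1 v, herm f2 v, herm f3 v]"
proof -
  define f :: "3 \<Rightarrow> complex^3" where "f i = vector [f1, f2, f3] $ i" for i
  have "herm f2 f1 = 0" "herm f3 f1 = 0" "herm f3 f2 = 0"
    using assms(4-6) cnj_herm by (metis complex_cnj_zero)+
  then have "\<forall>i j. herm (f i) (f j) = (if i = j then 1 else 0)"
    using assms unfolding f_def forall_3 by simp
  then have "unitary (\<chi> i j. cnj (f i $ j))" by (intro unitary_orthonormal_rows) blast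
  moreover have "(\<chi> i j. cnj (f i $ j)) *v v = vector [herm f1 v, herm f2 v, herm f3 v]" for v
    by (simp add: vec_eq_iff forall_3 matrix_vector_mult_def herm_def f_def)
  ultimately show ?thesis using that by blast
qed

text \<open>After rescaling, \<open>u\<close> and \<open>v\<close> have the same Gram matrix as
  \<open>(0, 1, -omega)\<close> and \<open>(0, 1, -omega^2)\<close>, so a unitary matrix matches the
  pairs; it sends the pole \<open>w\<close> to the first axis.\<close>

lemma unitary_normal_form:
  assumes uv: "u \<noteq> 0" "v \<noteq> 0" "4 * (cmod (herm u v))\<^sup>2 = (norm u)\<^sup>2 * (norm v)\<^sup>2"
    and w: "w \<noteq> 0" "herm w u = 0" "herm w v = 0"
  obtains A where "unitary A" "abs_cp2 (A *v u) = p1" "abs_cp2 (A *v v) = p2"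
    "\<And>x. herm w x = 0 \<Longrightarrow> (A *v x) $ 1 = 0"
proof -
  define a where "a = of_real (sqrt 2 / norm u) *s u"
  define h where "h = herm a v"
  have aa: "herm a a = 2"
    using uv(1) by (simp add: herm_self a_def norm_vector_smult norm_divide power_divide)
  have hv: "2 * (cmod h)\<^sup>2 = (norm v)\<^sup>2"
    using uv by (simp add: h_def a_def herm_smult_left norm_mult norm_divide power_divide
        power_mult_distrib field_simps)
  then have h: "h \<noteq> 0" using uv(2) by auto
  \<comment> \<open>The factor makes \<open>herm a b\<close> equal to
    \<open>1 + cnj omega * omega^2\<close>, the product of the two target vectors.\<close>
  define b where "b = (- omega\<^sup>2 / h) *s v"
  have ab: "herm a b = - omega\<^sup>2"
    unfolding b_def herm_smult_right h_def[symmetric] using h by simp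
  then have ba: "herm b a = - omega"
    using cnj_herm[of a b] cnj_omega by (metis complex_cnj_cnj complex_cnj_minus)
  have "(norm b)\<^sup>2 = 2"
    unfolding b_def norm_vector_smult
    using h hv by (simp add: norm_divide norm_power cmod_omega power_divide field_simps)
  then have bb: "herm b b = 2" by (simp add: herm_self)
  define d where "d = omega\<^sup>2 - omega"
  have "cnj (omega\<^sup>2) = omega" by (metis cnj_omega complex_cnj_cnj)
  then have d: "d \<noteq> 0" "cnj d = - d"
    unfolding d_def complex_cnj_diff cnj_omega using omega_neq(3) by simp_all
  have dd: "d * d = - 3" using omega_sum omega_cubed unfolding d_def by algebra
  \<comment> \<open>\<open>f2\<close> and \<open>f3\<close> solve \<open>a = f2 - omega f3\<close>
    and \<open>b = f2 - omega^2 f3\<close>, so they are the preimages of the second and third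
    axes.\<close>
  define f1 where "f1 = of_real (1 / norm w) *s w"
  define f3 where "f3 = (1 / d) *s (a - b)"
  define f2 where "f2 = a + omega *s f3"
  have wa: "herm w a = 0" and wb: "herm w b = 0"
    unfolding a_def b_def herm_smult_right using w by simp_all
  have f33: "herm f3 f3 = 1"
  proof -
    have "herm (a - b) (a - b) = 3"
      using omega_sum unfolding herm_diff_left herm_diff_right aa ab ba bb by algebra
    then show ?thesis unfolding f3_def herm_smult using d dd by simp
  qed
  have f3a: "herm f3 a = - omega"
  proof -
    have "- (2 + omega) = d * (- omega)"
      using omega_sum omega_cubed unfolding d_def by algebra
    then show ?thesis
      unfolding f3_def herm_smult_left herm_diff_left aa ba using d by (simp add: field_simps)
  qed
  have af3: "herm a f3 = - omega\<^sup>2" using f3a cnj_herm[of f3 a] by (simp add: cnj_omega)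
  have f23: "herm f2 f3 = 0"
    unfolding f2_def herm_add_left herm_smult_left by (simp add: af3 f33 cnj_omega)
  have f22: "herm f2 f2 = 1"
    using omega_cubed unfolding f2_def herm_add_left herm_add_right herm_smult_left herm_smult_right
      aa f33 f3a af3 cnj_omega by algebra
  have f11: "herm f1 f1 = 1" using w(1) by (simp add: f1_def herm_self norm_vector_smult norm_divide)
  have f13: "herm f1 f3 = 0" 
    unfolding f1_def f3_def herm_smult herm_diff_right by (simp add: wa wb)
  have f12: "herm f1 f2 = 0"
    unfolding f2_def herm_add_right herm_smult_right f13 by (simp add: f1_def herm_smult_left wa)
  obtain A where A: "unitary A" "\<And>v. A *v v = vector [herm f1 v, herm f2 v, herm f3 v]"
    using unitary_orthonormal_basis[OF f11 f22 f33 f12 f13 f23] by blast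
  have a: "a = f2 - omega *s f3" by (simp add: f2_def)
  have b: "b = f2 - omega\<^sup>2 *s f3"
  proof -
    have "d *s f3 = a - b" using d by (simp add: f3_def vector_smult_assoc)
    then have "b = a - (omega\<^sup>2 - omega) *s f3" by (simp add: d_def)
    then show ?thesis by (simp add: f2_def vec_eq_iff algebra_simps)
  qed
  have f32: "herm f3 f2 = 0" using f23 cnj_herm[of f2 f3] by simp
  have "A *v a = vector [0, 1, - omega]" "A *v b = vector [0, 1, - (omega\<^sup>2)]"
    unfolding A(2) a b herm_diff_right herm_smult_right f12 f13 f22 f23 f32 f33 by simp_all
  moreover have "abs_cp2 (A *v a) = abs_cp2 (A *v u)" "abs_cp2 (A *v b) = abs_cp2 (A *v v)"
    unfolding a_def b_def matrix_vector_mult_smult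
    by (rule abs_cp2_smult; use uv(1,2) A(1) h omega_neq in \<open>simp add: unitary_eq_0_iff\<close>)+
  moreover have "(A *v x) $ 1 = 0" if "herm w x = 0" for x
    using that unfolding A(2) by (simp add: f1_def herm_smult_left)
  ultimately show ?thesis using that A(1) by metis
qed

text \<open>Two of the collinear points are moved to \<open>p1\<close> and \<open>p2\<close>. The
  third then lies on \<open>z1 = 0\<close>, where equidistance from both leaves only
  \<open>p3\<close>.\<close>

lemma collinear_triple_isometric_midpoint:
  assumes SIC: "is_SIC S" and q: "quarter_overlaps S" and w: "w \<noteq> 0" "3 \<le> card (S \<inter> line w)"
  shows "\<exists>T. midpoint_solution T \<and> isometric S T"
proof -
  obtain R where "R \<subseteq> S \<inter> line w" "card R = 3"
    using obtain_subset_with_card_n[OF w(2)] by metis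
  then obtain p p' p'' where p: "p \<in> S \<inter> line w" "p' \<in> S \<inter> line w" "p'' \<in> S \<inter> line w"
      "p \<noteq> p'" "p \<noteq> p''" "p' \<noteq> p''"
    by (auto simp: card_3_iff)
  then obtain u v x where uvx: "p = abs_cp2 u" "u \<noteq> 0" "herm w u = 0"
      "p' = abs_cp2 v" "v \<noteq> 0" "herm w v = 0" "p'' = abs_cp2 x" "x \<noteq> 0" "herm w x = 0"
    unfolding line_def by blast
  have "4 * (cmod (herm u v))\<^sup>2 = (norm u)\<^sup>2 * (norm v)\<^sup>2"
    using quarter_overlapsD[OF q uvx(2,5)] p uvx(1,4) by blast
  then obtain A where A: "unitary A" "abs_cp2 (A *v u) = p1" "abs_cp2 (A *v v) = p2"
      "\<And>x. herm w x = 0 \<Longrightarrow> (A *v x) $ 1 = 0"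
    using unitary_normal_form[OF uvx(2,5) _ w(1) uvx(3,6)] by blast
  obtain F where F: "is_cp2_isometry F" "\<And>v. v \<noteq> 0 \<Longrightarrow> F (abs_cp2 v) = abs_cp2 (A *v v)"
    using unitary_induces_isometry[OF A(1)] by blast
  have inj: "inj F" using F(1) by (simp add: is_cp2_isometry_def bij_def)
  have Fp: "F p = p1" "F p' = p2" using F(2) uvx A by simp_all
  have SIC': "is_SIC (F ` S)" using is_SIC_unitary_image[OF SIC A(1) F] .
  have in_image: "p1 \<in> F ` S" "p2 \<in> F ` S" "F p'' \<in> F ` S" using Fp p by force+
  define b c where "b = (A *v x) $ 2" and "c = (A *v x) $ 3"
  have Ax: "A *v x = vector [0, b, c]"
    using vec3_eta[of "A *v x"] A(4)[OF uvx(9)] by (simp add: b_def c_def)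
  have nz: "vector [0, b, c] \<noteq> (0 :: complex^3)"
    using unitary_eq_0_iff[OF A(1)] uvx(8) Ax by metis
  have Fx: "F p'' = cpoint 0 b c" using F(2) uvx Ax by metis
  have "F p'' \<noteq> p1" "F p'' \<noteq> p2" using p inj Fp by (metis injD)+
  then have "0 = (cmod b)\<^sup>2 + (cmod c)\<^sup>2 + 2 * Re (cnj b * c)"
    using overlap_with_p1_p2(2)[OF is_SIC_quarter[OF SIC' in_image(1,2)] in_image(1,2) nz] Fx in_image(3)
    by simp
  \<comment> \<open>With vanishing first coordinate the overlap condition says
    \<open>|b + c|^2 = 0\<close>.\<close>
  then have "(cmod (b - (- 1) * c))\<^sup>2 = 0"
    using cmod_diff_unit_square[of "- 1" b c] by simp
  then have "c = - b" by (simp add: add_eq_0_iff)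
  moreover from this have "b \<noteq> 0" using nz by (auto simp: vec3_eq_0_iff)
  ultimately have "p3 = cpoint 0 b c" by (auto simp: cpoint_eq_iff vec3_eq_0_iff)
  then have "midpoint_solution (F ` S)"
    using SIC_midpoint_solution[OF SIC' in_image(1,2)] in_image(3) Fx by simp
  then show ?thesis using F(1) unfolding isometric_def by blast
qed

section \<open>The points \<open>zpt\<close> in normal form, and the conclusion\<close>

lemma cos_add_thirds: "cos (\<phi> + 2 / 3 * pi) + cos (\<phi> + 4 / 3 * pi) = - cos \<phi>"
proof -
  have "\<phi> + 2 / 3 * pi = (\<phi> + pi) - pi / 3" "\<phi> + 4 / 3 * pi = (\<phi> + pi) + pi / 3" by simp_all
  then show ?thesis
    by (simp only: cos_add[of "\<phi> + pi" "pi / 3"] cos_diff[of "\<phi> + pi" "pi / 3"]) (simp add: cos_60)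
qed

text \<open>The three cosines sum to zero, so the first one is minus the sum of the others; this
  accounts for the sign of the phase.\<close>

lemma zpt_eq_rpoint:
  "zpt \<sigma> \<phi> = rpoint (- exp (\<i> * of_real \<sigma>)) (cos (\<phi> + 2 / 3 * pi)) (cos (\<phi> + 4 / 3 * pi))"
  unfolding zpt_def cos_add_thirds by simp

theorem lemma8p2:
  fixes S :: "cp2 set" and \<theta> \<phi> \<sigma>\<^sub>1 \<sigma>\<^sub>2 :: real
  assumes "is_SIC S"
    and "cpoint 0 1 (- omega) \<in> S" and "cpoint 0 1 (- (omega ^ 2)) \<in> S"
    and "\<theta> \<in> {- pi / 2 <.. pi / 2}" and "zpt 0 \<theta> \<in> S"
    and "\<phi> \<in> {- pi / 2 <.. pi / 2}"
    and "\<sigma>\<^sub>1 \<in> {- pi <..< pi}" and "\<sigma>\<^sub>2 \<in> {- pi <..< pi}"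
    and "zpt \<sigma>\<^sub>1 \<phi> \<in> S" and "zpt \<sigma>\<^sub>2 \<phi> \<in> S" and "zpt \<sigma>\<^sub>1 \<phi> \<noteq> zpt \<sigma>\<^sub>2 \<phi>"
  shows "\<exists>T. midpoint_solution T \<and> isometric S T"
proof -
  have unit: "cmod (- exp (\<i> * of_real \<sigma>)) = 1" for \<sigma> :: real
    by (simp add: norm_exp_eq_Re)
  \<comment> \<open>Otherwise the first coordinate would vanish for both phases and the two points
    would coincide.\<close>
  have "cos \<phi> \<noteq> 0" using assms(11) unfolding zpt_def by auto
  then have "cos (\<phi> + 2 / 3 * pi) + cos (\<phi> + 4 / 3 * pi) \<noteq> 0" unfolding cos_add_thirds by simp
  from SIC_collinear_triple[OF assms(1-3) unit unit this assms(9-11)[unfolded zpt_eq_rpoint]]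
  obtain w where "w \<noteq> 0" "3 \<le> card (S \<inter> line w)" .
  then show ?thesis
    using collinear_triple_isometric_midpoint[OF assms(1) is_SIC_quarter[OF assms(1-3)]] by blast
qed

end
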